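(* Let $P$ be a FASP program. If $P$ has no loops in its positive dependency graph, then an interpretation $I$ of $P$ is an answer set of $P$ if and only if $I\models comp(P)$, where $comp(P)$ is the completion of $P$.
   Context: "Increasing" and "decreasing" are meant in the non-strict sense. A t-norm is an increasing, commutative, associative map $\mathcal{T}:[0,1]^2\to[0,1]$ with $\mathcal{T}(1,x)=x$ for all $x$; all t-norms are assumed left-continuous. The residual implicator of $\mathcal{T}$ is $\mathcal{I}(x,y)=\sup\{\lambda\in[0,1]\mid \mathcal{T}(x,\lambda)\le y\}$, and its biresiduum is $x\approx y=\mathcal{T}(\mathcal{I}(x,y),\mathcal{I}(y,x))$. A negator is a decreasing map $\mathcal{N}:[0,1]\to[0,1]$ with $\mathcal{N}(0)=1$, $\mathcal{N}(1)=0$. FASP programs. A literal is either an atom or a constant from $[0,1]$. An extended literal is either a literal (positive extended literal) or an expression $\mathcal{N}(a)$ with $a$ an atom and $\mathcal{N}$ an arbitrary negator (negative extended literal). A rule $r$ has the form $a\leftarrow \mathcal{T}(b_1,\ldots,b_n)$ with $n>0$, $a$ a literal (the head $H(r)$), $b_1,\ldots,b_n$ extended literals (forming the body $B(r)$) and $\mathcal{T}$ an arbitrary t-norm, where $\mathcal{T}(b)=b$ and $\mathcal{T}(b_1,\ldots,b_n)=\mathcal{T}(b_1,\mathcal{T}(b_2,\ldots))$. The t-norm and the negators may differ from rule to rule. $Lit^+(B(r))$ is the set of positive extended literals in the body of $r$, and $\mathcal{I}_r$ is the residual implicator of the t-norm in the body of $r$. A FASP program $P$ is a finite set of rules; $\mathcal{B}_P$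 is the finite set of all atoms occurring in $P$; for an atom $a$, $P_a$ is the set of rules of $P$ with head $a$. Interpretations. An interpretation $I$ of $P$ is a map $I:\mathcal{B}_P\to[0,1]$, extended by $I(c)=c$ for $c\in[0,1]$, $I(\mathcal{N}(a))=\mathcal{N}(I(a))$, $I(B(r))=\mathcal{T}(I(b_1),\ldots,I(b_n))$ and $I(r)=\mathcal{I}_r(I(B(r)),I(H(r)))$ for a rule $r: a\leftarrow\mathcal{T}(b_1,\ldots,b_n)$. $I$ is a model of $P$ iff $I(r)=1$ for every $r\in P$. The support is $supp(I)=\{a\in\mathcal{B}_P\mid I(a)>0\}$. Answer sets. A set $U\subseteq\mathcal{B}_P$ is unfounded w.r.t. $I$ iff for each $u\in U$ and each $r\in P_u$ at least one of the following holds: (1) $U\cap Lit^+(B(r))\ne\emptyset$; (2) $I(u)>I(B(r))$; (3) $I(B(r))=0$. $I$ is unfounded-free iff $supp(I)\cap U=\emptyset$ for every set $U$ unfounded w.r.t. $I$. An answer set of $P$ is a model of $P$ that is unfounded-free. Completion. Interpretations are extended truth-functionally to fuzzy formulas built from atoms, constants and connectives; $I\models F$ iff $I(F)=1$, and $I\models\Theta$ for a set $\Theta$ iff $I\models F$ for all $F\in\Theta$. The completion $comp(P)$ is the set of formulas $$\{a\approx \max\{B(r)\mid r\in P_a\}\mid a\in\mathcal{B}_P\}\cup\{\mathcal{I}_r(B(r),H(r))\mid r\in P,\ H(r)\in[0,1]\},$$ where $\approx$ is the biresiduum of an arbitrary residual implicator, $B(r)$ as a formula denotes $\mathcal{T}(b_1,\ldots,b_n)$,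 and $\max\emptyset=0$. Loops. The positive dependency graph of $P$ is the directed graph $G_P$ on $\mathcal{B}_P$ with an edge $(a,b)$ iff there is $r\in P_a$ with $b\in Lit^+(B(r))$. A non-empty set $L\subseteq\mathcal{B}_P$ is a loop of $P$ iff for all $a,b\in L$ there is a path of length $>0$ from $a$ to $b$ in $G_P$ all of whose vertices lie in $L$. *)

theory Defs
  imports Complex_Main "HOL-Library.FSet" "HOL-Library.FuncSet"
begin

text \<open>
  Connectives on the unit interval are represented by functions on all reals; only their
  values on \<open>{0..1}\<close> matter. Commutativity lets monotonicity and left-continuity
  be stated in the second argument only.
\<close>

definition tnorm :: "(real \<Rightarrow> real \<Rightarrow> real) \<Rightarrow> bool" where
  "tnorm T \<longleftrightarrow>
     (\<forall>x\<in>{0..1}. \<forall>y\<in>{0..1}. T x y \<in> {0..1}) \<and>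
     (\<forall>x\<in>{0..1}. mono_on {0..1} (T x)) \<and>
     (\<forall>x\<in>{0..1}. \<forall>y\<in>{0..1}. T x y = T y x) \<and>
     (\<forall>x\<in>{0..1}. \<forall>y\<in>{0..1}. \<forall>z\<in>{0..1}. T (T x y) z = T x (T y z)) \<and>
     (\<forall>x\<in>{0..1}. T 1 x = x)"

definition left_continuous_tnorm :: "(real \<Rightarrow> real \<Rightarrow> real) \<Rightarrow> bool" where
  "left_continuous_tnorm T \<longleftrightarrow>
     tnorm T \<and> (\<forall>x\<in>{0..1}. \<forall>y\<in>{0<..1}. continuous (at_left y) (T x))"

definition negator :: "(real \<Rightarrow> real) \<Rightarrow> bool" where
  "negator N \<longleftrightarrow>
     N \<in> {0..1} \<rightarrow> {0..1} \<and> antimono_on {0..1} N \<and> N 0 = 1 \<and> N 1 = 0"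

definition residual_implicator :: "(real \<Rightarrow> real \<Rightarrow> real) \<Rightarrow> real \<Rightarrow> real \<Rightarrow> real" where
  "residual_implicator T x y = Sup {l \<in> {0..1}. T x l \<le> y}"

definition biresiduum :: "(real \<Rightarrow> real \<Rightarrow> real) \<Rightarrow> real \<Rightarrow> real \<Rightarrow> real" where
  "biresiduum T x y = T (residual_implicator T x y) (residual_implicator T y x)"

datatype 'a lit = Atom 'a | Const real

datatype 'a ext_lit = Pos "'a lit" | Neg "real \<Rightarrow> real" 'a

text \<open>A rule carries its t-norm explicitly, since the t-norm also determines the
  implicator of the rule when the body consists of one extended literal only.\<close>

datatype (rule_atoms: 'a) rule =
  Rule (rhead: "'a lit") (rtnorm: "real \<Rightarrow> real \<Rightarrow> real") (rbody: "'a ext_lit list")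

type_synonym 'a program = "'a rule fset"

fun wf_lit :: "'a lit \<Rightarrow> bool" where
  "wf_lit (Atom a) = True"
| "wf_lit (Const c) = (c \<in> {0..1})"

fun wf_ext_lit :: "'a ext_lit \<Rightarrow> bool" where
  "wf_ext_lit (Pos l) = wf_lit l"
| "wf_ext_lit (Neg N a) = negator N"

definition wf_rule :: "'a rule \<Rightarrow> bool" where
  "wf_rule r \<longleftrightarrow> wf_lit (rhead r) \<and> left_continuous_tnorm (rtnorm r) \<and>
     rbody r \<noteq> [] \<and> (\<forall>b\<in>set (rbody r). wf_ext_lit b)"

definition fasp_program :: "'a program \<Rightarrow> bool" where
  "fasp_program P \<longleftrightarrow> (\<forall>r. r |\<in>| P \<longrightarrow> wf_rule r)"

definition atoms :: "'a program \<Rightarrow> 'a set" where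
  "atoms P = (\<Union>r\<in>fset P. rule_atoms r)"

definition rules_for :: "'a program \<Rightarrow> 'a \<Rightarrow> 'a program" where
  "rules_for P a = ffilter (\<lambda>r. rhead r = Atom a) P"

definition pos_lits :: "'a rule \<Rightarrow> 'a lit set" where
  "pos_lits r = {l. Pos l \<in> set (rbody r)}"

text \<open>The implication \<open>FImp T\<close> and the equivalence \<open>FEquiv T\<close> are
  annotated with the t-norm whose residual implicator, respectively biresiduum, they denote.\<close>

datatype 'a form =
    FLit "'a lit"
  | FNeg "real \<Rightarrow> real" "'a form"
  | FConj "real \<Rightarrow> real \<Rightarrow> real" "'a form" "'a form"
  | FImp "real \<Rightarrow> real \<Rightarrow> real" "'a form" "'a form"
  | FEquiv "real \<Rightarrow> real \<Rightarrow> real" "'a form" "'a form"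
  | FMax "'a form fset"

fun lit_val :: "('a \<Rightarrow> real) \<Rightarrow> 'a lit \<Rightarrow> real" where
  "lit_val I (Atom a) = I a"
| "lit_val I (Const c) = c"

primrec eval_form :: "('a \<Rightarrow> real) \<Rightarrow> 'a form \<Rightarrow> real" where
  "eval_form I (FLit l) = lit_val I l"
| "eval_form I (FNeg N F) = N (eval_form I F)"
| "eval_form I (FConj T F G) = T (eval_form I F) (eval_form I G)"
| "eval_form I (FImp T F G) = residual_implicator T (eval_form I F) (eval_form I G)"
| "eval_form I (FEquiv T F G) = biresiduum T (eval_form I F) (eval_form I G)"
| "eval_form I (FMax S) =
     (let V = eval_form I |`| S in if V = {||} then 0 else Max (fset V))"

definition satisfies :: "('a \<Rightarrow> real) \<Rightarrow> 'a form set \<Rightarrow> bool" where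
  "satisfies I \<Theta> \<longleftrightarrow> (\<forall>F\<in>\<Theta>. eval_form I F = 1)"

fun ext_lit_form :: "'a ext_lit \<Rightarrow> 'a form" where
  "ext_lit_form (Pos l) = FLit l"
| "ext_lit_form (Neg N a) = FNeg N (FLit (Atom a))"

text \<open>The value for the empty list is a dummy: rule bodies are non-empty.\<close>

fun conj_form :: "(real \<Rightarrow> real \<Rightarrow> real) \<Rightarrow> 'a ext_lit list \<Rightarrow> 'a form" where
  "conj_form T [] = FLit (Const 1)"
| "conj_form T [b] = ext_lit_form b"
| "conj_form T (b # c # bs) = FConj T (ext_lit_form b) (conj_form T (c # bs))"

definition body_form :: "'a rule \<Rightarrow> 'a form" where
  "body_form r = conj_form (rtnorm r) (rbody r)"

definition rule_form :: "'a rule \<Rightarrow> 'a form" where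
  "rule_form r = FImp (rtnorm r) (body_form r) (FLit (rhead r))"

definition interpretation_of :: "'a program \<Rightarrow> ('a \<Rightarrow> real) \<Rightarrow> bool" where
  "interpretation_of P I \<longleftrightarrow> I \<in> atoms P \<rightarrow> {0..1}"

definition model :: "'a program \<Rightarrow> ('a \<Rightarrow> real) \<Rightarrow> bool" where
  "model P I \<longleftrightarrow> (\<forall>r. r |\<in>| P \<longrightarrow> eval_form I (rule_form r) = 1)"

definition supp :: "'a program \<Rightarrow> ('a \<Rightarrow> real) \<Rightarrow> 'a set" where
  "supp P I = {a \<in> atoms P. I a > 0}"

definition unfounded :: "'a program \<Rightarrow> ('a \<Rightarrow> real) \<Rightarrow> 'a set \<Rightarrow> bool" where
  "unfounded P I U \<longleftrightarrow> U \<subseteq> atoms P \<and>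
     (\<forall>u\<in>U. \<forall>r. r |\<in>| rules_for P u \<longrightarrow>
        Atom ` U \<inter> pos_lits r \<noteq> {} \<or>
        I u > eval_form I (body_form r) \<or>
        eval_form I (body_form r) = 0)"

definition unfounded_free :: "'a program \<Rightarrow> ('a \<Rightarrow> real) \<Rightarrow> bool" where
  "unfounded_free P I \<longleftrightarrow> (\<forall>U. unfounded P I U \<longrightarrow> supp P I \<inter> U = {})"

definition answer_set :: "'a program \<Rightarrow> ('a \<Rightarrow> real) \<Rightarrow> bool" where
  "answer_set P I \<longleftrightarrow> interpretation_of P I \<and> model P I \<and> unfounded_free P I"

text \<open>The parameter \<open>T\<close> is the t-norm whose biresiduum is used for the equivalences.\<close>

definition completion :: "(real \<Rightarrow> real \<Rightarrow> real) \<Rightarrow> 'a program \<Rightarrow> 'a form set" where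
  "completion T P =
     {FEquiv T (FLit (Atom a)) (FMax (body_form |`| rules_for P a)) | a. a \<in> atoms P} \<union>
     {rule_form r | r. r |\<in>| P \<and> (\<exists>c\<in>{0..1}. rhead r = Const c)}"

definition dependency_graph :: "'a program \<Rightarrow> ('a \<times> 'a) set" where
  "dependency_graph P = {(a, b). \<exists>r. r |\<in>| rules_for P a \<and> Atom b \<in> pos_lits r}"

definition is_loop :: "'a program \<Rightarrow> 'a set \<Rightarrow> bool" where
  "is_loop P L \<longleftrightarrow> L \<noteq> {} \<and> L \<subseteq> atoms P \<and>
     (\<forall>a\<in>L. \<forall>b\<in>L. (a, b) \<in> (dependency_graph P \<inter> L \<times> L)\<^sup>+)"

end

theory Submission
  imports Defs
begin

text \<open>
  Since \<open>\<I>(x, y) = 1\<close> iff \<open>x \<le> y\<close>, satisfying the completion means that the constant-headed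
  rules hold and that every atom equals the largest value of its rule bodies. An answer set
  has this property because an atom exceeding all its bodies would form an unfounded singleton.
  Conversely, let an unfounded set meet the support. The value of a supported atom is attained by some rule body, so unfoundedness yields an
  edge to another atom of the set, which is again supported as a t-norm lies below
  its arguments. Iterating this contradicts the well-foundedness of a finite loop-free
  dependency graph.
\<close>

section \<open>T-norms, residual implicators and biresidua\<close>

lemma tnorm_mono_right:
  assumes "tnorm T" "x \<in> {0..1}" "y \<in> {0..1}" "z \<in> {0..1}" "y \<le> z"
  shows "T x y \<le> T x z"
  using assms unfolding tnorm_def by (blast intro: mono_onD)

lemma tnorm_1_right:
  assumes "tnorm T" "x \<in> {0..1}"
  shows "T x 1 = x"
  using assms unfolding tnorm_def by (metis atLeastAtMost_iff order_refl zero_le_one)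

text \<open>Raising the second argument to the neutral element 1 gives the bound by the left
  argument; commutativity gives the other one.\<close>

lemma
  assumes "tnorm T" "x \<in> {0..1}" "y \<in> {0..1}"
  shows tnorm_in_unit: "T x y \<in> {0..1}"
    and tnorm_le_left: "T x y \<le> x"
    and tnorm_le_right: "T x y \<le> y"
proof -
  have le: "T u v \<le> u" if "u \<in> {0..1}" "v \<in> {0..1}" for u v
    using tnorm_mono_right[of T u v 1] tnorm_1_right[of T u] assms(1) that by simp
  have comm: "T x y = T y x"
    using assms by (simp add: tnorm_def)
  show "T x y \<in> {0..1}" using assms by (simp add: tnorm_def)
  show "T x y \<le> x" using le assms by simp
  show "T x y \<le> y" using le[of y x] assms comm by simp
qed

lemma residual_implicator_in_unit:
  assumes "tnorm T" "x \<in> {0..1}" "y \<in> {0..1}"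
  shows "residual_implicator T x y \<in> {0..1}"
proof -
  let ?S = "{l \<in> {0..1}. T x l \<le> y}"
  have "0 \<in> ?S"
    using tnorm_le_right[of T x 0] assms by auto
  moreover have "bdd_above ?S"
    by (rule bdd_aboveI[of _ 1]) simp
  ultimately have "0 \<le> Sup ?S"
    by (rule cSup_upper)
  moreover have "Sup ?S \<le> 1"
    by (rule cSup_least) (use \<open>0 \<in> ?S\<close> in blast, simp)
  ultimately show ?thesis
    by (simp add: residual_implicator_def)
qed

text \<open>If \<open>x \<le> y\<close>, then 1 itself belongs to the set whose supremum is taken.
  Conversely, a supremum of 1 need not be attained a priori, so the bound is shown for all
  \<open>l < 1\<close> and left-continuity carries it to \<open>T x 1 = x\<close>.\<close>

lemma residual_implicator_eq_1_iff:
  assumes "left_continuous_tnorm T" "x \<in> {0..1}" "y \<in> {0..1}"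
  shows "residual_implicator T x y = 1 \<longleftrightarrow> x \<le> y"
proof
  let ?S = "{l \<in> {0..1}. T x l \<le> y}"
  have T: "tnorm T"
    using assms(1) by (simp add: left_continuous_tnorm_def)
  note one = tnorm_1_right[OF T assms(2)]
  have bdd: "bdd_above ?S"
    by (rule bdd_aboveI[of _ 1]) simp
  show "residual_implicator T x y = 1" if "x \<le> y"
  proof -
    have "1 \<in> ?S"
      using one that by simp
    then have "1 \<le> Sup ?S"
      by (rule cSup_upper) (rule bdd)
    then show ?thesis
      using residual_implicator_in_unit[OF T assms(2,3)] by (simp add: residual_implicator_def)
  qed
  show "x \<le> y" if eq: "residual_implicator T x y = 1"
  proof -
    have "0 \<in> ?S"
      using tnorm_le_right[of T x 0] T assms by auto
    then have ne: "?S \<noteq> {}" by blast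
    \<comment> \<open>Since the supremum is 1, some member \<open>m\<close> of the set exceeds
      \<open>l\<close>, and monotonicity passes its bound down.\<close>
    have below: "T x l \<le> y" if l: "l \<in> {0..<1}" for l
    proof -
      from l eq have "l < Sup ?S"
        by (simp add: residual_implicator_def)
      then obtain m where m: "m \<in> ?S" "l < m"
        using less_cSup_iff[OF ne bdd] by blast
      then have "T x l \<le> T x m"
        using tnorm_mono_right[OF T assms(2), of l m] l by simp
      with m show ?thesis by simp
    qed
    have "continuous (at_left 1) (T x)"
      using assms by (simp add: left_continuous_tnorm_def)
    then have "(T x \<longlongrightarrow> x) (at_left 1)"
      by (simp add: continuous_within one)
    \<comment> \<open>The witness 0 makes the whole open interval from 0 to 1 the left
      neighbourhood, where \<open>below\<close> applies.\<close>
    moreover have "eventually (\<lambda>l. T x l \<le> y) (at_left 1)"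
      unfolding eventually_at_left_field using below by (intro exI[of _ 0]) simp
    ultimately show "x \<le> y"
      by (rule tendsto_upperbound) (simp add: trivial_limit_at_left_real)
  qed
qed

text \<open>A t-norm lies below both arguments, so the value 1 forces both implications to be 1, and
  antisymmetry applies. Hence satisfaction of an equivalence does not depend on the choice of
  \<open>T\<close>.\<close>

lemma biresiduum_eq_1_iff:
  assumes "left_continuous_tnorm T" "x \<in> {0..1}" "y \<in> {0..1}"
  shows "biresiduum T x y = 1 \<longleftrightarrow> x = y"
proof -
  have T: "tnorm T"
    using assms(1) by (simp add: left_continuous_tnorm_def)
  have "T u v = 1 \<longleftrightarrow> u = 1 \<and> v = 1" if "u \<in> {0..1}" "v \<in> {0..1}" for u v
    using tnorm_le_left[OF T that] tnorm_le_right[OF T that] tnorm_1_right[OF T, of 1] that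
    by auto
  then show ?thesis
    using residual_implicator_in_unit[OF T] residual_implicator_eq_1_iff[OF assms(1)] assms(2,3)
    by (auto simp: biresiduum_def)
qed

section \<open>Values of rule bodies and rules\<close>

text \<open>The bound of a t-norm by its arguments is iterated along the nested conjunction. Both
  claims are proved in one induction, as the bounds need the values to lie in the unit
  interval.\<close>

lemma eval_conj_form_le:
  assumes "tnorm T" "\<And>b. b \<in> set bs \<Longrightarrow> eval_form I (ext_lit_form b) \<in> {0..1}"
  shows "eval_form I (conj_form T bs) \<in> {0..1}"
    and "b \<in> set bs \<Longrightarrow> eval_form I (conj_form T bs) \<le> eval_form I (ext_lit_form b)"
proof -
  have "eval_form I (conj_form T bs) \<in> {0..1} \<and>
    (\<forall>b\<in>set bs. eval_form I (conj_form T bs) \<le> eval_form I (ext_lit_form b))"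
    using assms
  proof (induction T bs rule: conj_form.induct)
    case (3 T b c bs)
    let ?x = "eval_form I (ext_lit_form b)" and ?y = "eval_form I (conj_form T (c # bs))"
    have x: "?x \<in> {0..1}" using 3 by simp
    have y: "?y \<in> {0..1}" "\<forall>b\<in>set (c # bs). ?y \<le> eval_form I (ext_lit_form b)"
      using 3 by auto
    show ?case
      using tnorm_in_unit[OF \<open>tnorm T\<close> x y(1)] tnorm_le_left[OF \<open>tnorm T\<close> x y(1)]
        tnorm_le_right[OF \<open>tnorm T\<close> x y(1)] y(2)
      by (auto intro: order_trans)
  qed auto
  then show "eval_form I (conj_form T bs) \<in> {0..1}"
    and "b \<in> set bs \<Longrightarrow> eval_form I (conj_form T bs) \<le> eval_form I (ext_lit_form b)"
    by blast+
qed

lemma atom_in_rule_atoms: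
  "Atom a \<in> pos_lits r \<Longrightarrow> a \<in> rule_atoms r"
  "Neg N a \<in> set (rbody r) \<Longrightarrow> a \<in> rule_atoms r"
  "rhead r = Atom a \<Longrightarrow> a \<in> rule_atoms r"
  by (cases r; force simp: pos_lits_def)+

lemma finite_rule_atoms: "finite (rule_atoms r)"
proof -
  have "finite (set_lit l)" for l :: "'a lit" by (cases l) auto
  moreover from this have "finite (set_ext_lit b)" for b :: "'a ext_lit" by (cases b) auto
  ultimately show ?thesis by (cases r) auto
qed

lemma finite_atoms: "finite (atoms P)"
  by (simp add: atoms_def finite_rule_atoms)

context
  fixes P :: "'a program" and I :: "'a \<Rightarrow> real"
  assumes P: "fasp_program P" and I: "interpretation_of P I"
begin

lemma atom_value_in_unit: "a \<in> rule_atoms r \<Longrightarrow> r |\<in>| P \<Longrightarrow> I a \<in> {0..1}"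
  using I by (auto simp: interpretation_of_def atoms_def Pi_iff)

text \<open>The second claim is what propagates the support along an edge of the dependency
  graph.\<close>

lemma
  assumes r: "r |\<in>| P"
  shows body_value_in_unit: "eval_form I (body_form r) \<in> {0..1}"
    and body_value_le_atom: "Atom a \<in> pos_lits r \<Longrightarrow> eval_form I (body_form r) \<le> I a"
proof -
  have wf: "wf_rule r"
    using P r by (simp add: fasp_program_def)
  then have T: "tnorm (rtnorm r)"
    by (simp add: wf_rule_def left_continuous_tnorm_def)
  have unit: "eval_form I (ext_lit_form b) \<in> {0..1}" if b: "b \<in> set (rbody r)" for b
  proof (cases b)
    case (Pos l)
    then show ?thesis
      using wf b atom_value_in_unit[OF _ r] atom_in_rule_atoms(1)[of _ r]
      by (cases l) (force simp: wf_rule_def pos_lits_def)+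
  next
    case (Neg N a)
    then have "negator N" "I a \<in> {0..1}"
      using wf b atom_value_in_unit[OF _ r] atom_in_rule_atoms(2)[of N a r]
      by (force simp: wf_rule_def)+
    then show ?thesis
      using Neg by (auto simp: negator_def Pi_iff)
  qed
  show "eval_form I (body_form r) \<in> {0..1}"
    using eval_conj_form_le(1)[OF T unit] by (simp add: body_form_def)
  show "eval_form I (body_form r) \<le> I a" if "Atom a \<in> pos_lits r"
    using eval_conj_form_le(2)[OF T unit, of "rbody r" "Pos (Atom a)"] that
    by (simp add: body_form_def pos_lits_def)
qed

lemma eval_rule_form_eq_1_iff:
  assumes r: "r |\<in>| P"
  shows "eval_form I (rule_form r) = 1 \<longleftrightarrow> eval_form I (body_form r) \<le> lit_val I (rhead r)"
proof -
  have wf: "wf_rule r"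
    using P r by (simp add: fasp_program_def)
  have "lit_val I (rhead r) \<in> {0..1}"
    using wf atom_value_in_unit[OF _ r] atom_in_rule_atoms(3)[of r]
    by (cases "rhead r") (auto simp: wf_rule_def)
  then show ?thesis
    using residual_implicator_eq_1_iff body_value_in_unit[OF r] wf
    by (simp add: rule_form_def wf_rule_def)
qed

section \<open>The completion as a system of maximum equations\<close>

abbreviation max_body_value :: "'a \<Rightarrow> real" where
  "max_body_value a \<equiv> eval_form I (FMax (body_form |`| rules_for P a))"

lemma fset_rules_for: "r |\<in>| rules_for P a \<longleftrightarrow> r |\<in>| P \<and> rhead r = Atom a"
  by (auto simp: rules_for_def)

lemma body_value_le_max: "r |\<in>| rules_for P a \<Longrightarrow> eval_form I (body_form r) \<le> max_body_value a"
  by (auto simp: Let_def fimage_iff intro!: Max_ge)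

text \<open>A maximum over finitely many rules is attained, so a positive value always comes from
  some rule.\<close>

lemma max_body_value_cases:
  obtains (empty) "rules_for P a = {||}" "max_body_value a = 0"
  | (attained) r where "r |\<in>| rules_for P a" "max_body_value a = eval_form I (body_form r)"
proof (cases "rules_for P a = {||}")
  case True
  then show ?thesis using empty by (simp add: Let_def)
next
  case False
  let ?V = "fset (eval_form I |`| body_form |`| rules_for P a)"
  have "?V \<noteq> {}" using False by (metis bot_fset.rep_eq fimage_is_fempty fset_inject)
  then have "Max ?V \<in> ?V" by (intro Max_in) auto
  then obtain r where "r |\<in>| rules_for P a" "Max ?V = eval_form I (body_form r)"
    by auto
  with False show ?thesis using attained by (simp add: Let_def)
qed

lemma max_body_value_in_unit: "max_body_value a \<in> {0..1}"
proof (cases a rule: max_body_value_cases)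
  case empty
  then show ?thesis by (simp del: eval_form.simps)
next
  case (attained r)
  then show ?thesis
    using body_value_in_unit[of r] by (simp add: fset_rules_for del: eval_form.simps)
qed

text \<open>The equation for an atom bounds every body of its rules by its value, so the rules with
  atomic heads hold automatically; the completion lists those with constant heads
  explicitly.\<close>

lemma satisfies_completion_iff:
  assumes "left_continuous_tnorm T"
  shows "satisfies I (completion T P) \<longleftrightarrow>
    model P I \<and> (\<forall>a\<in>atoms P. I a = max_body_value a)"
proof -
  have atom: "eval_form I (FEquiv T (FLit (Atom a)) (FMax (body_form |`| rules_for P a))) = 1
      \<longleftrightarrow> I a = max_body_value a" if "a \<in> atoms P" for a
    using biresiduum_eq_1_iff[OF assms _ max_body_value_in_unit, of "I a" a] that I
    by (auto simp: interpretation_of_def Pi_iff)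
  have "satisfies I (completion T P) \<longleftrightarrow> (\<forall>a\<in>atoms P. I a = max_body_value a) \<and>
      (\<forall>r. r |\<in>| P \<and> (\<exists>c\<in>{0..1}. rhead r = Const c) \<longrightarrow> eval_form I (rule_form r) = 1)"
    unfolding satisfies_def completion_def ball_Un using atom by blast
  moreover have "model P I"
    if max: "\<forall>a\<in>atoms P. I a = max_body_value a"
      and const: "\<forall>r. r |\<in>| P \<and> (\<exists>c\<in>{0..1}. rhead r = Const c) \<longrightarrow> eval_form I (rule_form r) = 1"
    unfolding model_def
  proof (intro allI impI)
    fix r assume r: "r |\<in>| P"
    show "eval_form I (rule_form r) = 1"
    proof (cases "rhead r")
      case (Atom a)
      then have "a \<in> atoms P"
        using r atom_in_rule_atoms(3)[of r a] by (auto simp: atoms_def)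
      with Atom show ?thesis
        using body_value_le_max[of r a] max r
        by (simp add: eval_rule_form_eq_1_iff fset_rules_for del: eval_form.simps)
    next
      case (Const c)
      \<comment> \<open>This puts \<open>c\<close> into the unit interval, so that the formula of
        \<open>r\<close> belongs to the completion.\<close>
      moreover have "wf_lit (rhead r)"
        using P r by (simp add: fasp_program_def wf_rule_def)
      ultimately show ?thesis
        using const r by auto
    qed
  qed
  ultimately show ?thesis
    unfolding model_def by blast
qed

text \<open>Being a model gives one inequality. If the other failed, \<open>I a\<close> would be
  positive and exceed every body value, making \<open>{a}\<close> an unfounded set that meets the
  support.\<close>

lemma answer_set_eq_max_body_value:
  assumes ans: "answer_set P I" and a: "a \<in> atoms P"
  shows "I a = max_body_value a"
proof (rule antisym)
  have bodies: "eval_form I (body_form r) \<le> I a" if "r |\<in>| rules_for P a" for r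
    using ans that eval_rule_form_eq_1_iff[of r]
    by (simp add: answer_set_def model_def fset_rules_for)
  \<comment> \<open>Handles an atom heading no rule, whose maximum is 0 by convention.\<close>
  have "I a \<ge> 0"
    using I a by (auto simp: interpretation_of_def Pi_iff)
  then show "max_body_value a \<le> I a"
    by (cases a rule: max_body_value_cases) (use bodies in auto)
  show "I a \<le> max_body_value a"
  proof (rule ccontr)
    assume "\<not> I a \<le> max_body_value a"
    then have less: "max_body_value a < I a" by simp
    then have "unfounded P I {a}"
      using a body_value_le_max by (fastforce simp: unfounded_def simp del: eval_form.simps)
    then have "a \<notin> supp P I"
      using ans by (auto simp: answer_set_def unfounded_free_def)
    then show False
      using less max_body_value_in_unit[of a] a by (simp add: supp_def del: eval_form.simps)
  qed
qed

end

section \<open>Loop-free dependency graphs and unfounded sets\<close>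

lemma dependency_graph_subset: "dependency_graph P \<subseteq> atoms P \<times> atoms P"
  by (auto simp: dependency_graph_def rules_for_def atoms_def intro: atom_in_rule_atoms)

text \<open>The strongly connected component of a vertex on a cycle is a loop.\<close>

lemma acyclic_if_no_loop:
  assumes "\<nexists>L. is_loop P L"
  shows "acyclic (dependency_graph P)"
proof (rule acyclicI, intro allI notI)
  let ?G = "dependency_graph P"
  fix a assume a: "(a, a) \<in> ?G\<^sup>+"
  define L where "L = {b. (a, b) \<in> ?G\<^sup>+ \<and> (b, a) \<in> ?G\<^sup>+}"
  \<comment> \<open>A path between members of \<open>L\<close> never leaves \<open>L\<close>: each
    intermediate vertex is reachable from \<open>a\<close> and leads back to
    \<open>a\<close>.\<close>
  have "(x, y) \<in> (?G \<inter> L \<times> L)\<^sup>+" if "(x, y) \<in> ?G\<^sup>+" "x \<in> L" "y \<in> L" for x y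
    using that
  proof (induction rule: converse_trancl_induct)
    case (base x)
    then show ?case by blast
  next
    case (step x z)
    then have "z \<in> L"
      by (auto simp: L_def intro: trancl_into_trancl trancl_trans)
    with step show ?case
      by (auto intro: trancl_into_trancl2)
  qed
  moreover have "(x, y) \<in> ?G\<^sup>+" if "x \<in> L" "y \<in> L" for x y
    using that by (auto simp: L_def intro: trancl_trans)
  moreover have "L \<subseteq> atoms P"
    using trancl_subset_Sigma[OF dependency_graph_subset[of P]] by (auto simp: L_def)
  moreover have "a \<in> L"
    using a by (simp add: L_def)
  ultimately have "is_loop P L"
    by (auto simp: is_loop_def)
  with assms show False by blast
qed

text \<open>The converse is taken so that a minimal element of a set is an atom with no successor in
  that set.\<close>

lemma wf_converse_dependency_graph:
  assumes "\<nexists>L. is_loop P L"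
  shows "wf ((dependency_graph P)\<inverse>)"
proof (rule finite_acyclic_wf_converse)
  show "finite (dependency_graph P)"
    using dependency_graph_subset finite_atoms by (metis finite_SigmaI finite_subset)
qed (rule acyclic_if_no_loop[OF assms])

lemma unfounded_free_if_eq_max_body_value:
  assumes P: "fasp_program P" and I: "interpretation_of P I"
    and no_loop: "\<nexists>L. is_loop P L"
    and max: "\<forall>a\<in>atoms P. I a = eval_form I (FMax (body_form |`| rules_for P a))"
  shows "unfounded_free P I"
  unfolding unfounded_free_def
proof (intro allI impI, rule ccontr)
  fix U assume U: "unfounded P I U" and ne: "supp P I \<inter> U \<noteq> {}"
  obtain u where u: "u \<in> supp P I \<inter> U"
    and last: "\<And>v. (u, v) \<in> dependency_graph P \<Longrightarrow> v \<notin> supp P I \<inter> U"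
    using wfE_min'[OF wf_converse_dependency_graph[OF no_loop] ne] by (metis converse_iff)
  \<comment> \<open>Since \<open>I u > 0\<close>, the maximum is not the default 0 and some rule
    attains it.\<close>
  obtain r where r: "r |\<in>| rules_for P u" and body: "eval_form I (body_form r) = I u"
    using u max by (cases u rule: max_body_value_cases[OF P I])
      (auto simp: supp_def simp del: eval_form.simps)
  \<comment> \<open>The body value equals \<open>I u\<close> and is positive, which excludes the
    other two alternatives of unfoundedness.\<close>
  with U u obtain v where v: "v \<in> U" "Atom v \<in> pos_lits r"
    by (force simp: unfounded_def supp_def)
  have "r |\<in>| P"
    using r by (simp add: rules_for_def)
  then have "I u \<le> I v"
    using body_value_le_atom[OF P I] v(2) body by metis
  then have "v \<in> supp P I \<inter> U"
    using u v(1) U by (auto simp: supp_def unfounded_def)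
  moreover have "(u, v) \<in> dependency_graph P"
    using r v(2) by (auto simp: dependency_graph_def)
  ultimately show False
    using last by blast
qed

theorem proposition3:
  fixes P :: "'a program" and I :: "'a \<Rightarrow> real" and T :: "real \<Rightarrow> real \<Rightarrow> real"
  assumes "fasp_program P"
    and "left_continuous_tnorm T"
    and "\<nexists>L. is_loop P L"
    and "interpretation_of P I"
  shows "answer_set P I \<longleftrightarrow> satisfies I (completion T P)"
  using satisfies_completion_iff[OF assms(1,4,2)] answer_set_eq_max_body_value[OF assms(1,4)]
    unfounded_free_if_eq_max_body_value[OF assms(1,4,3)] assms(4)
  by (auto simp: answer_set_def simp del: eval_form.simps)

end
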